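(* Let $n,m\ge1$ be integers, let $\mathbb{T}=\{g\in\mathbb{C} : |g|=1\}$ act on $\mathbb{C}^n$ by $\mathcal{A}(g,z):=gz$, let $f,g_1,\dots,g_m\in\mathbb{R}[\bar z,z]$ be real-valued complex polynomials on $\mathbb{C}^n$ with $K=\{z\in\mathbb{C}^n : g_i(z)\ge0,\ i=1,\dots,m\}$ compact, and assume that $f,g_1,\dots,g_m\in\mathbb{R}[\bar z,z]^{\mathbb{T}}$. Then, with the optimal values defined in the context (taken with $G=\mathbb{T}$), $\rho_d^{\mathbb{T}}=\rho_d$ and $(\rho_d^{\mathbb{T}})^*=\rho_d^*$ for all $d\ge d^{\min}$.
   Context: Notation. For $z\in\mathbb{C}^n$, $\alpha\in\mathbb{N}^n$: $z^\alpha=z_1^{\alpha_1}\cdots z_n^{\alpha_n}$, $|\alpha|=\alpha_1+\dots+\alpha_n$. $\mathbb{C}_d[z]$ is the set of holomorphic polynomials $\sum_{|\alpha|\le d}p_\alpha z^\alpha$ ($p_\alpha\in\mathbb{C}$); $\vec p:=(p_\alpha)_{|\alpha|\le d}$. $\mathbb{R}_d[\bar z,z]$ is the set of functions $\sum_{|\alpha|,|\beta|\le d}\varphi_{\alpha,\beta}\bar z^\alpha z^\beta$ ($\varphi_{\alpha,\beta}\in\mathbb{C}$) that are real-valued on $\mathbb{C}^n$; $\mathbb{R}[\bar z,z]=\bigcup_d\mathbb{R}_d[\bar z,z]$. $\Sigma_d[z]$ is the set of finite sums $\sum_{j=1}^r|p_j|^2$, $r\ge1$, with $p_j\in\mathbb{C}_d[z]$.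 Degrees. $f\in\mathbb{R}_k[\bar z,z]$, $g_i\in\mathbb{R}_{k_i}[\bar z,z]$, where there exist $|\alpha|=k$, $|\beta|\le k$ with $f_{\alpha,\beta}\ne0$, and $|\alpha|=k_i$, $|\beta|\le k_i$ with $g_{i,\alpha,\beta}\ne0$. $g_0:=1$, $k_0:=0$, $d^{\min}:=\max\{k,k_1,\dots,k_m\}$. Moments. $\mathcal{H}_d$ is the set of complex families $y=(y_{\alpha,\beta})_{|\alpha|,|\beta|\le d}$ with $\overline{y_{\alpha,\beta}}=y_{\beta,\alpha}$ (identified with Hermitian matrices). $L_y$ is linear with $L_y(\bar z^\alpha z^\beta)=y_{\alpha,\beta}$. $M_d(\varphi y)$ is the matrix indexed by $|\alpha|,|\beta|\le d$ with entries $\sum_{\gamma,\delta}\varphi_{\gamma,\delta}\,y_{\alpha+\gamma,\beta+\delta}$ for $\varphi=\sum\varphi_{\gamma,\delta}\bar z^\gamma z^\delta$. Invariance. For a group $G$ acting on $\mathbb{C}^n$ via $\mathcal{A}$ and $Y\subset\mathbb{R}[\bar z,z]$, $Y^G:=\{\varphi\in Y : \varphi(\mathcal{A}(g,z))=\varphi(z)\ \forall g\in G,\ z\in\mathbb{C}^n\}$. For $A\in\mathcal{H}_d$, $A\succcurlyeq^G0$ means $\vec p^{\,H}A\,\vec p\ge0$ for all $p\in\mathbb{C}_d[z]$ such that $|p|^2\in\Sigma_d[z]^G$. Optimal values, for $d\ge d^{\min}$: $$\rho_d:=\inf_{y\in\mathcal{H}_d}L_y(f)\ \text{ s.t. } y_{0,0}=1,\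 M_{d-k_i}(g_iy)\succcurlyeq0,\ i=0,\dots,m,$$ $$\rho_d^*:=\sup\Big\{\lambda\in\mathbb{R} : f-\lambda=\sum_{i=0}^m\sigma_ig_i,\ \sigma_i\in\Sigma_{d-k_i}[z]\Big\},$$ $$\rho_d^G:=\inf_{y\in\mathcal{H}_d}L_y(f)\ \text{ s.t. } y_{0,0}=1,\ M_{d-k_i}(g_iy)\succcurlyeq^G0,\ i=0,\dots,m,$$ $$(\rho_d^G)^*:=\sup\Big\{\lambda\in\mathbb{R} : f-\lambda=\sum_{i=0}^m\sigma_ig_i,\ \sigma_i\in\Sigma_{d-k_i}[z]^G\Big\}.$$ Infima over the empty set are $+\infty$, suprema over the empty set are $-\infty$. *)

theory Defs
  imports "HOL-Analysis.Analysis"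
begin

section \<open>Complex polynomials in \<open>z\<close> and \<open>cnj z\<close>\<close>

definition mdeg :: "nat ^ 'n \<Rightarrow> nat"
  where "mdeg \<alpha> = (\<Sum>i\<in>UNIV. \<alpha> $ i)"

definition zpow :: "complex ^ 'n \<Rightarrow> nat ^ 'n \<Rightarrow> complex"
  where "zpow z \<alpha> = (\<Prod>i\<in>UNIV. (z $ i) ^ (\<alpha> $ i))"

definition hol_eval :: "nat \<Rightarrow> (nat ^ 'n \<Rightarrow> complex) \<Rightarrow> complex ^ 'n \<Rightarrow> complex"
  where "hol_eval d p z = (\<Sum>\<alpha> | mdeg \<alpha> \<le> d. p \<alpha> * zpow z \<alpha>)"

definition hol_polys :: "nat \<Rightarrow> (complex ^ 'n \<Rightarrow> complex) set"
  where "hol_polys d = {q. \<exists>p. q = hol_eval d p}"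

text \<open>Real-valuedness of the polynomial function \<open>\<phi>\<close> is expressed by its type.\<close>

definition has_coeffs ::
    "(complex ^ 'n \<Rightarrow> real) \<Rightarrow> (nat ^ 'n \<Rightarrow> nat ^ 'n \<Rightarrow> complex) \<Rightarrow> bool"
  where "has_coeffs \<phi> c \<longleftrightarrow>
    finite {(\<alpha>, \<beta>). c \<alpha> \<beta> \<noteq> 0} \<and>
    (\<forall>z. complex_of_real (\<phi> z) =
      (\<Sum>(\<alpha>, \<beta>) | c \<alpha> \<beta> \<noteq> 0. c \<alpha> \<beta> * (cnj (zpow z \<alpha>) * zpow z \<beta>)))"

definition real_polys_deg :: "nat \<Rightarrow> (complex ^ 'n \<Rightarrow> real) set"
  where "real_polys_deg d =
    {\<phi>. \<exists>c. has_coeffs \<phi> c \<and> (\<forall>\<alpha> \<beta>. c \<alpha> \<beta> \<noteq> 0 \<longrightarrow> mdeg \<alpha> \<le> d \<and> mdeg \<beta> \<le> d)}"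

definition real_polys :: "(complex ^ 'n \<Rightarrow> real) set"
  where "real_polys = (\<Union>d. real_polys_deg d)"

text \<open>The coefficients of a polynomial function are unique (lemma \<open>has_coeffs_unique\<close>
  below), so the description picks out the coefficients whenever \<open>\<phi> \<in> real_polys\<close>.\<close>

definition poly_coeff :: "(complex ^ 'n \<Rightarrow> real) \<Rightarrow> nat ^ 'n \<Rightarrow> nat ^ 'n \<Rightarrow> complex"
  where "poly_coeff \<phi> = (THE c. has_coeffs \<phi> c)"

definition has_degree :: "(complex ^ 'n \<Rightarrow> real) \<Rightarrow> nat \<Rightarrow> bool"
  where "has_degree \<phi> k \<longleftrightarrow>
    \<phi> \<in> real_polys_deg k \<and>
    (\<exists>\<alpha> \<beta>. mdeg \<alpha> = k \<and> mdeg \<beta> \<le> k \<and> poly_coeff \<phi> \<alpha> \<beta> \<noteq> 0)"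

definition sos :: "nat \<Rightarrow> (complex ^ 'n \<Rightarrow> real) set"
  where "sos d =
    {\<sigma>. \<exists>(r::nat) p. r \<ge> 1 \<and> (\<forall>j\<in>{1..r}. p j \<in> hol_polys d) \<and>
          \<sigma> = (\<lambda>z. \<Sum>j=1..r. (cmod (p j z))\<^sup>2)}"

definition invariants ::
    "'g set \<Rightarrow> ('g \<Rightarrow> complex ^ 'n \<Rightarrow> complex ^ 'n) \<Rightarrow> (complex ^ 'n \<Rightarrow> real) set
      \<Rightarrow> (complex ^ 'n \<Rightarrow> real) set"
  where "invariants G act Y = {\<phi> \<in> Y. \<forall>g\<in>G. \<forall>z. \<phi> (act g z) = \<phi> z}"

definition circle_group :: "complex set"
  where "circle_group = {g. cmod g = 1}"

section \<open>Moment matrices\<close>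

text \<open>A matrix indexed by the multi-indices of degree at most \<open>d\<close> is extended by zero to
  all multi-indices.\<close>

definition hermitian_families :: "nat \<Rightarrow> (nat ^ 'n \<Rightarrow> nat ^ 'n \<Rightarrow> complex) set"
  where "hermitian_families d =
    {y. (\<forall>\<alpha> \<beta>. cnj (y \<alpha> \<beta>) = y \<beta> \<alpha>) \<and>
        (\<forall>\<alpha> \<beta>. \<not> (mdeg \<alpha> \<le> d \<and> mdeg \<beta> \<le> d) \<longrightarrow> y \<alpha> \<beta> = 0)}"

definition riesz :: "(nat ^ 'n \<Rightarrow> nat ^ 'n \<Rightarrow> complex) \<Rightarrow> (complex ^ 'n \<Rightarrow> real) \<Rightarrow> complex"
  where "riesz y \<phi> = (\<Sum>(\<alpha>, \<beta>) | poly_coeff \<phi> \<alpha> \<beta> \<noteq> 0. poly_coeff \<phi> \<alpha> \<beta> * y \<alpha> \<beta>)"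

definition moment_matrix ::
    "nat \<Rightarrow> (complex ^ 'n \<Rightarrow> real) \<Rightarrow> (nat ^ 'n \<Rightarrow> nat ^ 'n \<Rightarrow> complex)
      \<Rightarrow> nat ^ 'n \<Rightarrow> nat ^ 'n \<Rightarrow> complex"
  where "moment_matrix d \<phi> y \<alpha> \<beta> =
    (if mdeg \<alpha> \<le> d \<and> mdeg \<beta> \<le> d
     then \<Sum>(\<gamma>, \<delta>) | poly_coeff \<phi> \<gamma> \<delta> \<noteq> 0. poly_coeff \<phi> \<gamma> \<delta> * y (\<alpha> + \<gamma>) (\<beta> + \<delta>)
     else 0)"

definition quad_form ::
    "nat \<Rightarrow> (nat ^ 'n \<Rightarrow> nat ^ 'n \<Rightarrow> complex) \<Rightarrow> (nat ^ 'n \<Rightarrow> complex) \<Rightarrow> complex"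
  where "quad_form d A p =
    (\<Sum>\<alpha> | mdeg \<alpha> \<le> d. \<Sum>\<beta> | mdeg \<beta> \<le> d. cnj (p \<alpha>) * A \<alpha> \<beta> * p \<beta>)"

definition psd :: "nat \<Rightarrow> (nat ^ 'n \<Rightarrow> nat ^ 'n \<Rightarrow> complex) \<Rightarrow> bool"
  where "psd d A \<longleftrightarrow> (\<forall>p. quad_form d A p \<in> \<real>\<^sub>\<ge>\<^sub>0)"

definition psd_inv ::
    "'g set \<Rightarrow> ('g \<Rightarrow> complex ^ 'n \<Rightarrow> complex ^ 'n) \<Rightarrow> nat
      \<Rightarrow> (nat ^ 'n \<Rightarrow> nat ^ 'n \<Rightarrow> complex) \<Rightarrow> bool"
  where "psd_inv G act d A \<longleftrightarrow>
    (\<forall>p. (\<lambda>z. (cmod (hol_eval d p z))\<^sup>2) \<in> invariants G act (sos d)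
           \<longrightarrow> quad_form d A p \<in> \<real>\<^sub>\<ge>\<^sub>0)"

section \<open>The relaxations\<close>

text \<open>The constraints are \<open>g 1, \<dots>, g m\<close> with degrees \<open>k 1, \<dots>, k m\<close>; index \<open>0\<close> is
  overridden by the constant polynomial 1 of degree 0. The objective value
  \<open>riesz y f\<close> is real since \<open>y\<close> is Hermitian and \<open>f\<close> is real-valued.\<close>

abbreviation with_one :: "(nat \<Rightarrow> complex ^ 'n \<Rightarrow> real) \<Rightarrow> nat \<Rightarrow> complex ^ 'n \<Rightarrow> real"
  where "with_one g \<equiv> g(0 := (\<lambda>z. 1))"

abbreviation with_zero :: "(nat \<Rightarrow> nat) \<Rightarrow> nat \<Rightarrow> nat"
  where "with_zero k \<equiv> k(0 := 0)"

definition rho ::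
    "nat \<Rightarrow> (complex ^ 'n \<Rightarrow> real) \<Rightarrow> (nat \<Rightarrow> complex ^ 'n \<Rightarrow> real) \<Rightarrow> (nat \<Rightarrow> nat)
      \<Rightarrow> nat \<Rightarrow> ereal"
  where "rho m f g k d =
    Inf {ereal (Re (riesz y f)) | y. y \<in> hermitian_families d \<and> y 0 0 = 1 \<and>
      (\<forall>i\<in>{0..m}. psd (d - with_zero k i)
         (moment_matrix (d - with_zero k i) (with_one g i) y))}"

definition rho_dual ::
    "nat \<Rightarrow> (complex ^ 'n \<Rightarrow> real) \<Rightarrow> (nat \<Rightarrow> complex ^ 'n \<Rightarrow> real) \<Rightarrow> (nat \<Rightarrow> nat)
      \<Rightarrow> nat \<Rightarrow> ereal"
  where "rho_dual m f g k d =
    Sup {ereal t | t. \<exists>\<sigma>. (\<forall>i\<in>{0..m}. \<sigma> i \<in> sos (d - with_zero k i)) \<and>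
      (\<forall>z. f z - t = (\<Sum>i=0..m. \<sigma> i z * with_one g i z))}"

definition rho_inv ::
    "'g set \<Rightarrow> ('g \<Rightarrow> complex ^ 'n \<Rightarrow> complex ^ 'n) \<Rightarrow> nat \<Rightarrow> (complex ^ 'n \<Rightarrow> real)
      \<Rightarrow> (nat \<Rightarrow> complex ^ 'n \<Rightarrow> real) \<Rightarrow> (nat \<Rightarrow> nat) \<Rightarrow> nat \<Rightarrow> ereal"
  where "rho_inv G act m f g k d =
    Inf {ereal (Re (riesz y f)) | y. y \<in> hermitian_families d \<and> y 0 0 = 1 \<and>
      (\<forall>i\<in>{0..m}. psd_inv G act (d - with_zero k i)
         (moment_matrix (d - with_zero k i) (with_one g i) y))}"

definition rho_inv_dual ::
    "'g set \<Rightarrow> ('g \<Rightarrow> complex ^ 'n \<Rightarrow> complex ^ 'n) \<Rightarrow> nat \<Rightarrow> (complex ^ 'n \<Rightarrow> real)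
      \<Rightarrow> (nat \<Rightarrow> complex ^ 'n \<Rightarrow> real) \<Rightarrow> (nat \<Rightarrow> nat) \<Rightarrow> nat \<Rightarrow> ereal"
  where "rho_inv_dual G act m f g k d =
    Sup {ereal t | t. \<exists>\<sigma>. (\<forall>i\<in>{0..m}. \<sigma> i \<in> invariants G act (sos (d - with_zero k i))) \<and>
      (\<forall>z. f z - t = (\<Sum>i=0..m. \<sigma> i z * with_one g i z))}"

definition d_min :: "nat \<Rightarrow> nat \<Rightarrow> (nat \<Rightarrow> nat) \<Rightarrow> nat"
  where "d_min m kf k = Max (insert kf (k ` {1..m}))"

section \<open>Uniqueness of coefficients\<close>

lemma characters_independent:
  fixes X :: "'k \<Rightarrow> 'm \<Rightarrow> complex"
  assumes "finite S"
    and "\<And>k a b. k \<in> S \<Longrightarrow> X k (mul a b) = X k a * X k b"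
    and "\<And>k. k \<in> S \<Longrightarrow> X k e = 1"
    and "inj_on X S"
    and "\<And>a. (\<Sum>k\<in>S. c k * X k a) = 0"
  shows "\<forall>k\<in>S. c k = 0"
  using assms
proof (induction S arbitrary: c rule: finite_induct)
  case empty
  then show ?case by simp
next
  case (insert s S)
  have sum0: "(\<Sum>k\<in>S. c k * X k a) = - (c s * X s a)" for a
    using insert.prems(4)[of a] insert.hyps by (simp add: add_eq_0_iff)
  have "\<forall>k\<in>S. c k * (X k b - X s b) = 0" for b
  proof (rule insert.IH)
    fix a
    have "(\<Sum>k\<in>S. c k * (X k b - X s b) * X k a)
        = (\<Sum>k\<in>S. c k * X k (mul b a)) - X s b * (\<Sum>k\<in>S. c k * X k a)"
      unfolding sum_distrib_left sum_subtractf[symmetric]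
      by (rule sum.cong) (simp_all add: insert.prems(1) algebra_simps)
    also have "\<dots> = 0"
      unfolding sum0 using insert.prems(1)[of s b a] by simp
    finally show "(\<Sum>k\<in>S. c k * (X k b - X s b) * X k a) = 0" .
  qed (use insert.prems in auto)
  moreover have "\<exists>b. X k b \<noteq> X s b" if "k \<in> S" for k
    using that insert.prems(3) insert.hyps(2) by (auto simp: inj_on_def fun_eq_iff)
  ultimately have cS: "\<forall>k\<in>S. c k = 0"
    by (metis eq_iff_diff_eq_0 mult_eq_0_iff)
  then have "c s * X s e = 0"
    using sum0[of e] by simp
  then show ?case
    using cS insert.prems(2) by simp
qed

lemma zpow_axis: "zpow (\<chi> j. if j = i then w else 1) \<alpha> = w ^ (\<alpha> $ i)"
proof -
  have "zpow (\<chi> j. if j = i then w else 1) \<alpha> = (\<Prod>j\<in>UNIV. if j = i then w ^ (\<alpha> $ i) else 1)"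
    unfolding zpow_def by (rule prod.cong) auto
  then show ?thesis by simp
qed

lemma cnj_power_mult_power_eq:
  assumes "\<And>w::complex. cnj w ^ a * w ^ b = cnj w ^ a' * w ^ b'"
  shows "a = a'" "b = b'"
proof -
  have "cmod (cnj 2 ^ a * 2 ^ b) = cmod (cnj 2 ^ a' * 2 ^ b')"
    using assms[of 2] by (rule arg_cong)
  then have "(2::real) ^ (a + b) = 2 ^ (a' + b')"
    by (simp only: norm_mult norm_power complex_mod_cnj norm_numeral power_add)
  then have s: "a + b = a' + b'"
    by (rule power_inject_exp[THEN iffD1, rotated]) simp
  define t where "t = 1 / (1 + real (b + b' + a + a'))"
  have "cnj (cis t) ^ p * cis t ^ q = cis (t * (real q - real p))" for p q
  proof -
    have "cnj (cis t) ^ p * cis t ^ q = cis (real p * (- t)) * cis (real q * t)"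
      by (simp only: cis_cnj Complex.DeMoivre)
    also have "\<dots> = cis (t * (real q - real p))"
      unfolding cis_mult by (rule arg_cong) (simp add: algebra_simps)
    finally show ?thesis .
  qed
  then have "cis (t * (real b - real a)) = cis (t * (real b' - real a'))"
    using assms[of "cis t"] by simp
  then have "cis (t * (real b - real a) - t * (real b' - real a')) = 1"
    by (simp flip: cis_divide)
  from arg_cong[OF this, of Re] have "cos (t * (real b - real a - (real b' - real a'))) = 1"
    by (simp only: cis.sel one_complex.sel right_diff_distrib)
  then obtain n :: int where n: "t * (real b - real a - (real b' - real a')) = of_int n * 2 * pi"
    unfolding cos_one_2pi_int by auto
  have "\<bar>t * (real b - real a - (real b' - real a'))\<bar> < 1"
    unfolding t_def by (simp add: abs_mult field_simps)
  then have "\<bar>real_of_int n\<bar> * (2 * pi) < 1"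
    unfolding n by (simp add: abs_mult)
  moreover have "\<bar>real_of_int n\<bar> * 1 \<le> \<bar>real_of_int n\<bar> * (2 * pi)"
    using pi_gt3 by (intro mult_left_mono) auto
  ultimately have "n = 0" by linarith
  then have "real b - real a - (real b' - real a') = 0"
    using n by (simp add: t_def)
  with s show "a = a'" "b = b'" by linarith+
qed

lemma zpow_pair_inj:
  "inj (\<lambda>(\<alpha> :: nat ^ 'n, \<beta> :: nat ^ 'n) z. cnj (zpow z \<alpha>) * zpow z \<beta>)"
proof (rule injI, clarify)
  fix \<alpha> \<beta> \<alpha>' \<beta>' :: "nat ^ 'n"
  assume eq: "(\<lambda>z. cnj (zpow z \<alpha>) * zpow z \<beta>) = (\<lambda>z. cnj (zpow z \<alpha>') * zpow z \<beta>')"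
  have "cnj w ^ (\<alpha> $ i) * w ^ (\<beta> $ i) = cnj w ^ (\<alpha>' $ i) * w ^ (\<beta>' $ i)" for w i
    using fun_cong[OF eq, of "\<chi> j. if j = i then w else 1"] by (simp add: zpow_axis)
  then show "\<alpha> = \<alpha>' \<and> \<beta> = \<beta>'"
    by (metis cnj_power_mult_power_eq vec_eq_iff)
qed

lemma has_coeffs_unique:
  assumes "has_coeffs \<phi> c" and "has_coeffs \<phi> c'"
  shows "c = c'"
proof -
  define S where "S = {(\<alpha>, \<beta>). c \<alpha> \<beta> \<noteq> 0} \<union> {(\<alpha>, \<beta>). c' \<alpha> \<beta> \<noteq> 0}"
  define X where "X = (\<lambda>(\<alpha> :: nat ^ 'a, \<beta> :: nat ^ 'a) z. cnj (zpow z \<alpha>) * zpow z \<beta>)"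
  have fin: "finite S"
    using assms by (simp add: S_def has_coeffs_def)
  have ev: "complex_of_real (\<phi> z) = (\<Sum>k\<in>S. b (fst k) (snd k) * X k z)"
    if "has_coeffs \<phi> b" and "{(\<alpha>, \<beta>). b \<alpha> \<beta> \<noteq> 0} \<subseteq> S" for b z
  proof -
    have "complex_of_real (\<phi> z) =
        (\<Sum>k\<in>{(\<alpha>, \<beta>). b \<alpha> \<beta> \<noteq> 0}. b (fst k) (snd k) * X k z)"
      using that(1) by (simp add: has_coeffs_def X_def case_prod_unfold)
    also have "\<dots> = (\<Sum>k\<in>S. b (fst k) (snd k) * X k z)"
      by (rule sum.mono_neutral_left[OF fin that(2)]) auto
    finally show ?thesis .
  qed
  have diff0: "\<forall>k\<in>S. c (fst k) (snd k) - c' (fst k) (snd k) = 0"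
  proof (rule characters_independent[where X = X and e = 1 and mul = "\<lambda>x y. \<chi> i. x $ i * y $ i"])
    show "inj_on X S"
      unfolding X_def using zpow_pair_inj by (rule inj_on_subset) simp
    show "X k (\<chi> i. x $ i * y $ i) = X k x * X k y" for k x y
      by (cases k) (simp add: X_def zpow_def power_mult_distrib prod.distrib)
    show "X k 1 = 1" for k
      by (cases k) (simp add: X_def zpow_def)
    show "(\<Sum>k\<in>S. (c (fst k) (snd k) - c' (fst k) (snd k)) * X k z) = 0" for z
      using ev[OF assms(1), of z] ev[OF assms(2), of z]
      by (simp add: left_diff_distrib sum_subtractf S_def)
  qed (fact fin)
  have eqS: "c \<alpha> \<beta> = c' \<alpha> \<beta>" if "(\<alpha>, \<beta>) \<in> S" for \<alpha> \<beta>
    using bspec[OF diff0 that] by simp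
  show ?thesis
  proof (intro ext)
    fix \<alpha> \<beta>
    show "c \<alpha> \<beta> = c' \<alpha> \<beta>"
    proof (cases "(\<alpha>, \<beta>) \<in> S")
      case True
      then show ?thesis by (rule eqS)
    qed (simp add: S_def)
  qed
qed

lemma poly_coeff_eq: "has_coeffs \<phi> c \<Longrightarrow> poly_coeff \<phi> = c"
  unfolding poly_coeff_def using has_coeffs_unique by blast

end

theory Submission
  imports Defs
begin

text \<open>Decompose polynomials into homogeneous parts.  A circle-invariant function has only
  coefficients with \<open>mdeg \<alpha> = mdeg \<beta>\<close>.  Hence deleting the entries of \<open>y\<close> with
  \<open>mdeg \<alpha> \<noteq> mdeg \<beta>\<close> changes neither the objective nor the diagonal blocks of the moment
  matrices, which become block diagonal, so that positivity on homogeneous polynomials (whose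
  squared moduli are invariant) is positivity.  Dually, average a certificate over the roots of
  unity of an order exceeding all degrees: by Parseval, \<open>\<bar>p\<bar>\<^sup>2\<close> is replaced by the sum of the
  squared moduli of the homogeneous parts of \<open>p\<close>.\<close>

section \<open>Homogeneous parts\<close>

lemma zpow_scale: "zpow (w *s z) \<alpha> = w ^ mdeg \<alpha> * zpow z \<alpha>"
  by (simp add: zpow_def mdeg_def power_mult_distrib prod.distrib power_sum)

lemma mdeg_add: "mdeg (\<alpha> + \<beta>) = mdeg \<alpha> + mdeg \<beta>"
  by (simp add: mdeg_def sum.distrib)

definition hom_part :: "nat \<Rightarrow> (nat ^ 'n \<Rightarrow> complex) \<Rightarrow> nat ^ 'n \<Rightarrow> complex"
  where "hom_part j p \<alpha> = (if mdeg \<alpha> = j then p \<alpha> else 0)"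

lemma hol_eval_hom_part_scale:
  "hol_eval d (hom_part j p) (w *s z) = w ^ j * hol_eval d (hom_part j p) z"
  unfolding hol_eval_def sum_distrib_left
  by (rule sum.cong) (auto simp: hom_part_def zpow_scale)

lemma hol_eval_sum_hom_part:
  "hol_eval d p z = (\<Sum>j\<le>d. hol_eval d (hom_part j p) z)"
proof -
  have "(\<Sum>j\<le>d. hol_eval d (hom_part j p) z)
      = (\<Sum>\<alpha> | mdeg \<alpha> \<le> d. \<Sum>j\<le>d. hom_part j p \<alpha> * zpow z \<alpha>)"
    unfolding hol_eval_def by (rule sum.swap)
  also have "\<dots> = (\<Sum>\<alpha> | mdeg \<alpha> \<le> d. p \<alpha> * zpow z \<alpha>)"
  proof (rule sum.cong[OF refl])
    fix \<alpha> :: "nat ^ 'a"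
    assume "\<alpha> \<in> {\<alpha>. mdeg \<alpha> \<le> d}"
    moreover have "(\<Sum>j\<le>d. hom_part j p \<alpha> * zpow z \<alpha>)
        = (\<Sum>j\<le>d. if j = mdeg \<alpha> then p \<alpha> * zpow z \<alpha> else 0)"
      by (rule sum.cong) (auto simp: hom_part_def)
    ultimately show "(\<Sum>j\<le>d. hom_part j p \<alpha> * zpow z \<alpha>) = p \<alpha> * zpow z \<alpha>"
      by simp
  qed
  finally show ?thesis by (simp add: hol_eval_def)
qed

lemma hol_eval_scale_sum_hom_part:
  "hol_eval d p (w *s z) = (\<Sum>j\<le>d. w ^ j * hol_eval d (hom_part j p) z)"
  by (simp add: hol_eval_sum_hom_part[of d p] hol_eval_hom_part_scale)

lemma cmod_hom_part_invariant:
  "cmod w = 1 \<Longrightarrow>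
    cmod (hol_eval d (hom_part j p) (w *s z)) = cmod (hol_eval d (hom_part j p) z)"
  by (simp add: hol_eval_hom_part_scale norm_mult norm_power)

text \<open>Frees sums of squares from the index set \<open>{1..r}\<close>; a bijection from
  \<open>{1..card J}\<close> transports them, and \<open>J \<noteq> {}\<close> provides
  \<open>r \<ge> 1\<close>.\<close>

lemma sos_sumI:
  assumes "finite J" "J \<noteq> {}" "\<And>j. j \<in> J \<Longrightarrow> q j \<in> hol_polys d"
  shows "(\<lambda>z. \<Sum>j\<in>J. (cmod (q j z))\<^sup>2) \<in> sos d"
proof -
  obtain h where h: "bij_betw h {1..card J} J"
    using ex_bij_betw_nat_finite_1[OF assms(1)] by blast
  have "(\<lambda>z. \<Sum>j\<in>J. (cmod (q j z))\<^sup>2) = (\<lambda>z. \<Sum>j=1..card J. (cmod (q (h j) z))\<^sup>2)"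
    using sum.reindex_bij_betw[OF h, symmetric] by fast
  moreover have "q (h j) \<in> hol_polys d" if "j \<in> {1..card J}" for j
    using assms(3) bij_betwE[OF h] that by blast
  moreover have "card J \<ge> 1"
    using assms(1,2) by (simp add: Suc_leI card_gt_0_iff)
  ultimately show ?thesis
    unfolding sos_def mem_Collect_eq
    by (intro exI[of _ "card J"] exI[of _ "\<lambda>j. q (h j)"]) simp
qed

text \<open>Rotation by \<open>w\<close> multiplies a form of degree \<open>j\<close> by
  \<open>w ^ j\<close>, of modulus 1. Hence homogeneous polynomials are admissible tests in
  \<open>psd_inv\<close>.\<close>

lemma hom_part_square_invariant:
  "(\<lambda>z. (cmod (hol_eval d (hom_part j p) z))\<^sup>2) \<in> invariants circle_group (*s) (sos d)"
proof -
  have "(\<lambda>z. \<Sum>i\<in>{0::nat}. (cmod (hol_eval d (hom_part j p) z))\<^sup>2) \<in> sos d"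
    by (rule sos_sumI) (auto simp: hol_polys_def)
  then show ?thesis
    by (simp add: invariants_def circle_group_def cmod_hom_part_invariant)
qed

section \<open>Coefficients of invariant polynomials\<close>

lemma one_real_poly: "(\<lambda>z. 1) \<in> (real_polys :: (complex ^ 'n \<Rightarrow> real) set)"
proof -
  define c :: "nat ^ 'n \<Rightarrow> nat ^ 'n \<Rightarrow> complex"
    where "c = (\<lambda>\<alpha> \<beta>. if \<alpha> = 0 \<and> \<beta> = 0 then 1 else 0)"
  have "{(\<alpha>, \<beta>). c \<alpha> \<beta> \<noteq> 0} = {(0, 0)}"
    by (auto simp: c_def)
  then have "has_coeffs (\<lambda>z. 1) c"
    by (simp add: has_coeffs_def c_def zpow_def)
  moreover have "c \<alpha> \<beta> \<noteq> 0 \<longrightarrow> mdeg \<alpha> \<le> 0 \<and> mdeg \<beta> \<le> 0" for \<alpha> \<beta>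
    by (simp add: c_def mdeg_def)
  ultimately show ?thesis
    unfolding real_polys_def real_polys_deg_def by blast
qed

text \<open>Rotation by \<open>w\<close> multiplies the coefficient at
  \<open>(\<alpha>, \<beta>)\<close> by \<open>cnj w ^ mdeg \<alpha> * w ^ mdeg \<beta>\<close>.
  Since coefficients are unique, invariance forces this factor to be 1 wherever the coefficient is
  nonzero.\<close>

lemma invariant_coeff_degrees:
  assumes "\<phi> \<in> invariants circle_group (*s) real_polys" and nz: "poly_coeff \<phi> \<alpha> \<beta> \<noteq> 0"
  shows "mdeg \<alpha> = mdeg \<beta>"
proof (rule ccontr)
  assume neq: "mdeg \<alpha> \<noteq> mdeg \<beta>"
  obtain c where c: "has_coeffs \<phi> c"
    using assms(1) by (auto simp: invariants_def real_polys_def real_polys_deg_def)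
  \<comment> \<open>The angle is chosen so that the factor at \<open>(\<alpha>, \<beta>)\<close>
    becomes \<open>cis pi\<close>, that is -1; the denominator is nonzero by
    \<open>neq\<close>.\<close>
  define t where "t = pi / (real (mdeg \<beta>) - real (mdeg \<alpha>))"
  define w where "w = cis t"
  define c' where "c' = (\<lambda>\<alpha> \<beta>. cnj w ^ mdeg \<alpha> * w ^ mdeg \<beta> * c \<alpha> \<beta>)"
  have w: "cmod w = 1" "w \<noteq> 0" by (simp_all add: w_def)
  \<comment> \<open>The factor never vanishes, so both coefficient families are summed over the same
    support and can be compared termwise.\<close>
  have supp: "{(\<alpha>, \<beta>). c' \<alpha> \<beta> \<noteq> 0} = {(\<alpha>, \<beta>). c \<alpha> \<beta> \<noteq> 0}"
    using w by (simp add: c'_def)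
  have "has_coeffs \<phi> c'"
    unfolding has_coeffs_def supp
  proof (intro conjI allI)
    show "finite {(\<alpha>, \<beta>). c \<alpha> \<beta> \<noteq> 0}"
      using c by (simp add: has_coeffs_def)
    fix z
    have "complex_of_real (\<phi> z) = complex_of_real (\<phi> (w *s z))"
      using assms(1) w by (simp add: invariants_def circle_group_def)
    also have "\<dots> = (\<Sum>(\<alpha>, \<beta>) | c \<alpha> \<beta> \<noteq> 0.
        c \<alpha> \<beta> * (cnj (zpow (w *s z) \<alpha>) * zpow (w *s z) \<beta>))"
      using c unfolding has_coeffs_def by blast
    also have "\<dots> = (\<Sum>(\<alpha>, \<beta>) | c \<alpha> \<beta> \<noteq> 0. c' \<alpha> \<beta> * (cnj (zpow z \<alpha>) * zpow z \<beta>))"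
      by (rule sum.cong) (auto simp: zpow_scale c'_def)
    finally show "complex_of_real (\<phi> z)
        = (\<Sum>(\<alpha>, \<beta>) | c \<alpha> \<beta> \<noteq> 0. c' \<alpha> \<beta> * (cnj (zpow z \<alpha>) * zpow z \<beta>))" .
  qed
  then have "c' \<alpha> \<beta> = c \<alpha> \<beta>"
    using has_coeffs_unique[OF _ c] by metis
  moreover have "c \<alpha> \<beta> \<noteq> 0"
    using nz poly_coeff_eq[OF c] by simp
  ultimately have "cnj w ^ mdeg \<alpha> * w ^ mdeg \<beta> = 1"
    by (simp add: c'_def)
  moreover have "cnj w ^ mdeg \<alpha> * w ^ mdeg \<beta>
      = cis (real (mdeg \<alpha>) * (- t) + real (mdeg \<beta>) * t)"
    by (simp only: w_def cis_cnj Complex.DeMoivre cis_mult)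
  moreover have "real (mdeg \<alpha>) * (- t) + real (mdeg \<beta>) * t
      = t * (real (mdeg \<beta>) - real (mdeg \<alpha>))"
    by (simp add: algebra_simps)
  moreover have "t * (real (mdeg \<beta>) - real (mdeg \<alpha>)) = pi"
    using neq by (simp add: t_def)
  ultimately show False by simp
qed

section \<open>Block-diagonal truncation of moments\<close>

text \<open>The pinching of \<open>A\<close> to the blocks of equal degree, which is the average of
  \<open>cnj w ^ mdeg \<alpha> * w ^ mdeg \<beta> * A \<alpha> \<beta>\<close> over the
  circle.\<close>

definition diag_part :: "(nat ^ 'n \<Rightarrow> nat ^ 'n \<Rightarrow> complex) \<Rightarrow> nat ^ 'n \<Rightarrow> nat ^ 'n \<Rightarrow> complex"
  where "diag_part A \<alpha> \<beta> = (if mdeg \<alpha> = mdeg \<beta> then A \<alpha> \<beta> else 0)"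

lemma diag_part_hermitian:
  "y \<in> hermitian_families d \<Longrightarrow> diag_part y \<in> hermitian_families d"
  by (auto simp: hermitian_families_def diag_part_def)

lemma riesz_diag_part:
  assumes "\<phi> \<in> invariants circle_group (*s) real_polys"
  shows "riesz (diag_part y) \<phi> = riesz y \<phi>"
  unfolding riesz_def
  by (rule sum.cong) (auto simp: diag_part_def dest: invariant_coeff_degrees[OF assms])

text \<open>Each nonzero coefficient of \<open>\<phi>\<close> shifts row and column degrees by the
  same amount, so the shifted pair has equal degrees exactly when \<open>(\<alpha>, \<beta>)\<close>
  has.\<close>

lemma moment_matrix_diag_part:
  assumes "\<phi> \<in> invariants circle_group (*s) real_polys"
  shows "moment_matrix d \<phi> (diag_part y) = diag_part (moment_matrix d \<phi> y)"
proof (intro ext)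
  fix \<alpha> \<beta> :: "nat ^ 'a"
  have "(\<Sum>(\<gamma>, \<delta>) | poly_coeff \<phi> \<gamma> \<delta> \<noteq> 0. poly_coeff \<phi> \<gamma> \<delta> * diag_part y (\<alpha> + \<gamma>) (\<beta> + \<delta>))
    = (\<Sum>(\<gamma>, \<delta>) | poly_coeff \<phi> \<gamma> \<delta> \<noteq> 0.
        if mdeg \<alpha> = mdeg \<beta> then poly_coeff \<phi> \<gamma> \<delta> * y (\<alpha> + \<gamma>) (\<beta> + \<delta>) else 0)"
    by (rule sum.cong)
      (auto simp: diag_part_def mdeg_add dest: invariant_coeff_degrees[OF assms])
  then show "moment_matrix d \<phi> (diag_part y) \<alpha> \<beta> = diag_part (moment_matrix d \<phi> y) \<alpha> \<beta>"
    by (simp add: moment_matrix_def diag_part_def)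
qed

lemma quad_form_diag_part:
  "quad_form d (diag_part A) p = (\<Sum>j\<le>d. quad_form d A (hom_part j p))"
proof -
  let ?B = "{\<alpha> :: nat ^ 'a. mdeg \<alpha> \<le> d}"
  have "(\<Sum>j\<le>d. quad_form d A (hom_part j p))
    = (\<Sum>\<alpha>\<in>?B. \<Sum>\<beta>\<in>?B. \<Sum>j\<le>d. cnj (hom_part j p \<alpha>) * A \<alpha> \<beta> * hom_part j p \<beta>)"
    unfolding quad_form_def by (subst sum.swap) (rule sum.cong[OF refl], rule sum.swap)
  also have "\<dots> = (\<Sum>\<alpha>\<in>?B. \<Sum>\<beta>\<in>?B. cnj (p \<alpha>) * diag_part A \<alpha> \<beta> * p \<beta>)"
  proof (intro sum.cong refl)
    fix \<alpha> \<beta> :: "nat ^ 'a"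
    assume "\<alpha> \<in> ?B"
    \<comment> \<open>The product of the two homogeneous coefficients vanishes unless both degrees
      equal \<open>j\<close>; the one possible index, \<open>mdeg \<alpha>\<close>, lies in the
      range because \<open>mdeg \<alpha> \<le> d\<close>.\<close>
    moreover have "(\<Sum>j\<le>d. cnj (hom_part j p \<alpha>) * A \<alpha> \<beta> * hom_part j p \<beta>)
        = (\<Sum>j\<le>d. if j = mdeg \<alpha> then cnj (p \<alpha>) * diag_part A \<alpha> \<beta> * p \<beta> else 0)"
      by (rule sum.cong) (auto simp: hom_part_def diag_part_def)
    ultimately show "(\<Sum>j\<le>d. cnj (hom_part j p \<alpha>) * A \<alpha> \<beta> * hom_part j p \<beta>)
        = cnj (p \<alpha>) * diag_part A \<alpha> \<beta> * p \<beta>"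
      by simp
  qed
  finally show ?thesis by (simp add: quad_form_def)
qed

lemma psd_diag_part:
  assumes "psd_inv circle_group (*s) d A"
  shows "psd d (diag_part A)"
  unfolding psd_def quad_form_diag_part
proof
  fix p
  have "quad_form d A (hom_part j p) \<in> \<real>\<^sub>\<ge>\<^sub>0" for j
    using assms hom_part_square_invariant unfolding psd_inv_def by blast
  then show "(\<Sum>j\<le>d. quad_form d A (hom_part j p)) \<in> \<real>\<^sub>\<ge>\<^sub>0"
    by (simp add: complex_nonneg_Reals_iff sum_nonneg)
qed

section \<open>Equality of the primal values\<close>

lemma with_one_invariant:
  assumes "\<And>i. i \<in> {1..m} \<Longrightarrow> g i \<in> invariants circle_group (*s) real_polys"
    and "i \<in> {0..m}"
  shows "with_one g i \<in> invariants circle_group (*s) real_polys"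
  using assms one_real_poly by (auto simp: invariants_def)

lemma rho_inv_eq_rho:
  fixes f :: "complex ^ 'n \<Rightarrow> real"
  assumes f: "f \<in> invariants circle_group (*s) real_polys"
    and g: "\<And>i. i \<in> {1..m} \<Longrightarrow> g i \<in> invariants circle_group (*s) real_polys"
  shows "rho_inv circle_group (*s) m f g k d = rho m f g k d"
proof (rule antisym)
  \<comment> \<open>\<open>psd\<close> tests all polynomials, so the feasible set of
    \<open>rho\<close> lies inside that of \<open>rho_inv\<close>.\<close>
  have "psd e A \<Longrightarrow> psd_inv circle_group (*s) e A" for e and A :: "nat ^ 'n \<Rightarrow> nat ^ 'n \<Rightarrow> complex"
    by (simp add: psd_def psd_inv_def)
  then show "rho_inv circle_group (*s) m f g k d \<le> rho m f g k d"
    unfolding rho_inv_def rho_def by (intro Inf_superset_mono) blast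
  show "rho m f g k d \<le> rho_inv circle_group (*s) m f g k d"
    unfolding rho_inv_def
  proof (rule Inf_greatest, clarify)
    fix y :: "nat ^ 'n \<Rightarrow> nat ^ 'n \<Rightarrow> complex"
    assume y: "y \<in> hermitian_families d" "y 0 0 = 1"
      and p: "\<forall>i\<in>{0..m}. psd_inv circle_group (*s) (d - with_zero k i)
        (moment_matrix (d - with_zero k i) (with_one g i) y)"
    \<comment> \<open>The truncation \<open>diag_part y\<close> is the witness for the reverse
      inequality: truncating \<open>y\<close> truncates every moment matrix, and
      \<open>psd_diag_part\<close> upgrades invariant positivity to full positivity.\<close>
    have "\<forall>i\<in>{0..m}. psd (d - with_zero k i)
        (moment_matrix (d - with_zero k i) (with_one g i) (diag_part y))"
    proof
      fix i assume i: "i \<in> {0..m}"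
      show "psd (d - with_zero k i)
          (moment_matrix (d - with_zero k i) (with_one g i) (diag_part y))"
        using moment_matrix_diag_part[OF with_one_invariant[of m g i]] g i
          psd_diag_part[OF bspec[OF p i]] by simp
    qed
    moreover have "diag_part y 0 0 = 1"
      using y(2) by (simp add: diag_part_def)
    ultimately show "rho m f g k d \<le> ereal (Re (riesz y f))"
      unfolding rho_def
      using diag_part_hermitian[OF y(1)] riesz_diag_part[OF f, of y]
      by (intro Inf_lower CollectI exI[of _ "diag_part y"]) simp
  qed
qed

section \<open>Averaging over roots of unity\<close>

text \<open>Orthogonality of the characters of the cyclic group of order \<open>N\<close>.\<close>

lemma sum_cis_root_powers:
  assumes "j < N" "j' < N"
  shows "(\<Sum>l<N. (cis (2 * pi * real l / real N)) ^ j * cnj (cis (2 * pi * real l / real N) ^ j'))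
    = (if j = j' then of_nat N else 0)"
proof -
  \<comment> \<open>Since \<open>l\<close> and \<open>j\<close> enter the angle symmetrically, the
    \<open>j\<close>-th power of the \<open>l\<close>-th root is the \<open>l\<close>-th power of
    the \<open>j\<close>-th root. The sum over \<open>l\<close> is thus geometric with ratio
    \<open>q\<close>.\<close>
  define q where "q = cis (2 * pi * real j / real N) * cnj (cis (2 * pi * real j' / real N))"
  have N: "N > 0" using assms by simp
  have "(cis (2 * pi * real l / real N)) ^ j * cnj (cis (2 * pi * real l / real N) ^ j') = q ^ l" for l
    unfolding q_def complex_cnj_power[symmetric] power_mult_distrib
    by (simp add: Complex.DeMoivre mult_ac)
  then have eq: "(\<Sum>l<N. (cis (2 * pi * real l / real N)) ^ j
      * cnj (cis (2 * pi * real l / real N) ^ j')) = (\<Sum>l<N. q ^ l)"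
    by simp
  have one: "cis x * cnj (cis x) = 1" for x
    by (simp add: cis_cnj cis_mult)
  show ?thesis
  proof (cases "j = j'")
    case True
    then have "q = 1" by (simp add: q_def one)
    then show ?thesis using True eq by simp
  next
    case False
    \<comment> \<open>Distinct exponents below \<open>N\<close> give distinct roots of unity, so
      \<open>q\<close> differs from 1 and the geometric sum vanishes by
      \<open>q ^ N = 1\<close>.\<close>
    have inj: "inj_on (\<lambda>l. cis (2 * pi * real l / real N)) {..<N}"
      using Complex.bij_betw_roots_unity[OF N] by (rule bij_betw_imp_inj_on)
    have "q \<noteq> 1"
    proof
      assume "q = 1"
      then have "cis (2 * pi * real j / real N) = cis (2 * pi * real j' / real N)"
        unfolding q_def cis_cnj cis_inverse[symmetric]
        by (simp add: field_simps)
      then show False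
        using inj_onD[OF inj] assms False by blast
    qed
    moreover have "q ^ N = 1"
    proof -
      have "cis (2 * pi * real i / real N) ^ N = cis (2 * pi) ^ i" for i
        using N unfolding Complex.DeMoivre by (simp add: mult_ac)
      then have "cis (2 * pi * real i / real N) ^ N = 1" for i
        by simp
      then show ?thesis
        by (simp add: q_def power_mult_distrib flip: complex_cnj_power)
    qed
    ultimately show ?thesis
      using False eq by (simp add: geometric_sum)
  qed
qed

text \<open>Parseval for the discrete Fourier transform: expanding the squared moduli and summing
  over \<open>l\<close> first kills the cross terms.\<close>

lemma roots_of_unity_parseval:
  fixes a :: "nat \<Rightarrow> complex"
  shows "(\<Sum>l<N. (cmod (\<Sum>j<N. cis (2 * pi * real l / real N) ^ j * a j))\<^sup>2)
    = real N * (\<Sum>j<N. (cmod (a j))\<^sup>2)"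
proof -
  let ?w = "\<lambda>l. cis (2 * pi * real l / real N)"
  have "complex_of_real (\<Sum>l<N. (cmod (\<Sum>j<N. ?w l ^ j * a j))\<^sup>2)
      = (\<Sum>l<N. \<Sum>j<N. \<Sum>j'<N. (?w l ^ j * cnj (?w l ^ j')) * (a j * cnj (a j')))"
    by (simp only: of_real_sum complex_norm_square cnj_sum complex_cnj_mult sum_product mult_ac)
  also have "\<dots> = (\<Sum>j<N. \<Sum>j'<N. (\<Sum>l<N. ?w l ^ j * cnj (?w l ^ j')) * (a j * cnj (a j')))"
    unfolding sum_distrib_right by (subst sum.swap) (rule sum.cong[OF refl], rule sum.swap)
  also have "\<dots> = (\<Sum>j<N. \<Sum>j'<N. if j = j' then of_nat N * (a j * cnj (a j')) else 0)"
    by (intro sum.cong refl) (simp add: sum_cis_root_powers del: complex_cnj_power)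
  also have "\<dots> = complex_of_real (real N * (\<Sum>j<N. (cmod (a j))\<^sup>2))"
    by (simp add: sum_distrib_left flip: complex_norm_square)
  finally show ?thesis by (simp only: of_real_eq_iff)
qed

section \<open>Averages of sums of squares\<close>

text \<open>A finite substitute for the Haar integral over the circle, exact on squared moduli of
  polynomials of degree below \<open>N\<close>.\<close>

definition circle_avg :: "nat \<Rightarrow> (complex ^ 'n \<Rightarrow> real) \<Rightarrow> complex ^ 'n \<Rightarrow> real"
  where "circle_avg N \<sigma> z = (\<Sum>l<N. \<sigma> (cis (2 * pi * real l / real N) *s z)) / real N"

lemma circle_avg_square:
  assumes "d < N"
  shows "circle_avg N (\<lambda>z. (cmod (hol_eval d p z))\<^sup>2) z
    = (\<Sum>j\<le>d. (cmod (hol_eval d (hom_part j p) z))\<^sup>2)"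
proof -
  \<comment> \<open>The homogeneous values are padded with zeros beyond \<open>d\<close>, because
    Parseval runs over all \<open>j < N\<close>.\<close>
  define a where "a j = (if j \<le> d then hol_eval d (hom_part j p) z else 0)" for j
  have sub: "{..d} \<subseteq> {..<N}" using assms by auto
  have "hol_eval d p (w *s z) = (\<Sum>j<N. w ^ j * a j)" for w
    unfolding hol_eval_scale_sum_hom_part
    by (rule sum.mono_neutral_cong_left) (use sub in \<open>auto simp: a_def\<close>)
  moreover have "(\<Sum>j\<le>d. (cmod (hol_eval d (hom_part j p) z))\<^sup>2) = (\<Sum>j<N. (cmod (a j))\<^sup>2)"
    by (rule sum.mono_neutral_cong_left) (use sub in \<open>auto simp: a_def\<close>)
  ultimately show ?thesis
    using assms by (simp add: circle_avg_def roots_of_unity_parseval)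
qed

lemma circle_avg_sum:
  "circle_avg N (\<lambda>z. \<Sum>i\<in>I. h i z) z = (\<Sum>i\<in>I. circle_avg N (h i) z)"
  unfolding circle_avg_def by (subst sum.swap) (simp add: sum_divide_distrib)

text \<open>An invariant factor is constant along the averaged orbit, so averaging a certificate
  changes only its multipliers.\<close>

lemma circle_avg_mult_invariant:
  assumes "\<phi> \<in> invariants circle_group (*s) Y"
  shows "circle_avg N (\<lambda>z. \<sigma> z * \<phi> z) z = circle_avg N \<sigma> z * \<phi> z"
  using assms
  by (simp add: circle_avg_def invariants_def circle_group_def sum_distrib_right)

lemma circle_avg_invariant:
  assumes "N > 0" "\<And>w z. cmod w = 1 \<Longrightarrow> \<phi> (w *s z) = \<phi> z"
  shows "circle_avg N \<phi> z = \<phi> z"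
  using assms by (simp add: circle_avg_def)

lemma circle_avg_sos:
  assumes "\<sigma> \<in> sos d" "d < N"
  shows "circle_avg N \<sigma> \<in> invariants circle_group (*s) (sos d)"
proof -
  obtain r :: nat and q where r: "r \<ge> 1" and q: "\<forall>i\<in>{1..r}. q i \<in> hol_polys d"
    and \<sigma>: "\<sigma> = (\<lambda>z. \<Sum>i=1..r. (cmod (q i z))\<^sup>2)"
    using assms(1) by (auto simp: sos_def)
  obtain p where p: "\<forall>i\<in>{1..r}. q i = hol_eval d (p i)"
    using q unfolding hol_polys_def mem_Collect_eq by metis
  have \<sigma>': "\<sigma> = (\<lambda>z. \<Sum>i=1..r. (cmod (hol_eval d (p i) z))\<^sup>2)"
    using p by (simp add: \<sigma>)
  have "circle_avg N \<sigma> = (\<lambda>z. \<Sum>(i, j)\<in>{1..r} \<times> {..d}. (cmod (hol_eval d (hom_part j (p i)) z))\<^sup>2)"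
    by (rule ext)
      (simp add: \<sigma>' circle_avg_sum circle_avg_square[OF assms(2)] sum.cartesian_product)
  then have eq: "circle_avg N \<sigma>
      = (\<lambda>z. \<Sum>x\<in>{1..r} \<times> {..d}. (cmod (hol_eval d (hom_part (snd x) (p (fst x))) z))\<^sup>2)"
    by (simp add: case_prod_unfold)
  have "circle_avg N \<sigma> \<in> sos d"
    unfolding eq by (rule sos_sumI) (use r in \<open>auto simp: hol_polys_def\<close>)
  \<comment> \<open>Invariance under the whole circle, not merely under the roots of unity, comes
    from the expression \<open>eq\<close> in homogeneous squares.\<close>
  moreover have "circle_avg N \<sigma> (w *s z) = circle_avg N \<sigma> z" if "cmod w = 1" for w z
    unfolding eq using that by (simp add: cmod_hom_part_invariant)
  ultimately show ?thesis
    by (simp add: invariants_def circle_group_def)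
qed

section \<open>Equality of the dual values\<close>

lemma rho_inv_dual_eq_rho_dual:
  fixes f :: "complex ^ 'n \<Rightarrow> real"
  assumes f: "f \<in> invariants circle_group (*s) real_polys"
    and g: "\<And>i. i \<in> {1..m} \<Longrightarrow> g i \<in> invariants circle_group (*s) real_polys"
  shows "rho_inv_dual circle_group (*s) m f g k d = rho_dual m f g k d"
proof (rule antisym)
  show "rho_inv_dual circle_group (*s) m f g k d \<le> rho_dual m f g k d"
    unfolding rho_inv_dual_def rho_dual_def invariants_def by (intro Sup_subset_mono) blast
  show "rho_dual m f g k d \<le> rho_inv_dual circle_group (*s) m f g k d"
    unfolding rho_dual_def
  proof (rule Sup_least, clarify)
    fix t :: real and \<sigma>
    assume \<sigma>: "\<forall>i\<in>{0..m}. \<sigma> i \<in> sos (d - with_zero k i)"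
      and eq: "\<forall>z. f z - t = (\<Sum>i=0..m. \<sigma> i z * with_one g i z)"
    \<comment> \<open>The order \<open>Suc d\<close> exceeds every degree bound
      \<open>d - with_zero k i\<close>, so a single average serves all multipliers.\<close>
    define \<tau> where "\<tau> i = circle_avg (Suc d) (\<sigma> i)" for i
    have "\<tau> i \<in> invariants circle_group (*s) (sos (d - with_zero k i))" if "i \<in> {0..m}" for i
      unfolding \<tau>_def by (rule circle_avg_sos[OF bspec[OF \<sigma> that]]) simp
    moreover have "f z - t = (\<Sum>i=0..m. \<tau> i z * with_one g i z)" for z
    proof -
      \<comment> \<open>Averaging fixes the left side of the certificate because \<open>f\<close> is
        invariant; the right side is averaged term by term.\<close>
      have "f z - t = circle_avg (Suc d) (\<lambda>z. f z - t) z"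
        by (rule circle_avg_invariant[symmetric])
          (use f in \<open>simp_all add: invariants_def circle_group_def\<close>)
      also have "\<dots> = (\<Sum>i=0..m. circle_avg (Suc d) (\<lambda>z. \<sigma> i z * with_one g i z) z)"
        using eq by (simp only: circle_avg_sum)
      also have "\<dots> = (\<Sum>i=0..m. \<tau> i z * with_one g i z)"
        unfolding \<tau>_def
        by (intro sum.cong refl circle_avg_mult_invariant[OF with_one_invariant[OF g]])
      finally show ?thesis .
    qed
    ultimately show "ereal t \<le> rho_inv_dual circle_group (*s) m f g k d"
      unfolding rho_inv_dual_def by (intro Sup_upper) blast
  qed
qed

theorem proposition3p14:
  fixes m :: nat
    and f :: "complex ^ 'n \<Rightarrow> real"
    and g :: "nat \<Rightarrow> complex ^ 'n \<Rightarrow> real"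
    and kf :: nat
    and k :: "nat \<Rightarrow> nat"
  assumes "m \<ge> 1"
    and "f \<in> invariants circle_group (*s) real_polys"
    and "\<And>i. i \<in> {1..m} \<Longrightarrow> g i \<in> invariants circle_group (*s) real_polys"
    and "has_degree f kf"
    and "\<And>i. i \<in> {1..m} \<Longrightarrow> has_degree (g i) (k i)"
    and "compact {z. \<forall>i\<in>{1..m}. g i z \<ge> 0}"
  shows "\<forall>d \<ge> d_min m kf k.
           rho_inv circle_group (*s) m f g k d = rho m f g k d \<and>
           rho_inv_dual circle_group (*s) m f g k d = rho_dual m f g k d"
  using rho_inv_eq_rho[of f m g] rho_inv_dual_eq_rho_dual[of f m g] assms(2,3) by blast

end
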